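(* Let $A\in\mathbb{C}^{n\times n}$ have index $k$ and satisfy $\operatorname{rank}(A^{\sim}AA^{\sim})=\operatorname{rank}(A)$, let $b\in\mathbb{C}^{n}$, and let $t=\operatorname{rank}(A^{k})$. Assume $V\in\mathbb{C}^{n\times(n-t)}$ and $W\in\mathbb{C}^{(n-t)\times n}$ are such that $\mathcal{R}(V)=\mathcal{N}(A^{k})$ and $\mathcal{N}(W)=\mathcal{R}(A^{k})$. Denote $E=V(WV)^{-1}W$. Then the components of $x=A^{D,\mathfrak{m}}b$ are given by $$x_i=\frac{\det\big((A^{k}+E)(i\to A^{k}A^{\mathfrak{m}}b)\big)}{\det(A^{k}+E)},\qquad i=1,2,\dots,n.$$
   Context: $\mathcal{R}(\cdot)$ and $\mathcal{N}(\cdot)$ denote range and null space. For $M\in\mathbb{C}^{n\times n}$ and $c\in\mathbb{C}^{n}$, $M(i\to c)$ is the matrix obtained from $M$ by replacing its $i$th column with $c$. The index of $A\in\mathbb{C}^{n\times n}$ is the smallest nonnegative integer $k$ with $\operatorname{rank}(A^{k+1})=\operatorname{rank}(A^{k})$. The Minkowski metric matrix of order $n$ is $G=\operatorname{diag}(1,-I_{n-1})$. For $A\in\mathbb{C}^{n\times n}$, the Minkowski adjoint is $A^{\sim}=GA^{*}G$, where $A^*$ is the conjugate transpose. The Drazin inverse $A^{D}$ of $A$ (of index $k$) is the unique $X$ with $XAX=X$, $AX=XA$, $A^{k+1}X=A^{k}$. The Minkowski inverse $A^{\mathfrak{m}}$ is the unique matrix $X$ (if it exists) with $AXA=A$, $XAX=X$,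 $(AX)^{\sim}=AX$, $(XA)^{\sim}=XA$; it exists if and only if $\operatorname{rank}(A^{\sim}AA^{\sim})=\operatorname{rank}(A)$. When it exists, the $\mathfrak{m}$-DMP inverse of $A$ is $A^{D,\mathfrak{m}}=A^{D}AA^{\mathfrak{m}}$. *)

theory Defs
  imports
    Complex_Main
    "Jordan_Normal_Form.Matrix"
    "Jordan_Normal_Form.Determinant"
    "Jordan_Normal_Form.Gauss_Jordan_Elimination"
    "Jordan_Normal_Form.Matrix_Kernel"
    "Jordan_Normal_Form.Schur_Decomposition"
    "Jordan_Normal_Form.DL_Rank"
begin

abbreviation mat_rank :: "complex mat \<Rightarrow> nat" where
  "mat_rank A \<equiv> vec_space.rank (dim_row A) A"

abbreviation mat_range :: "complex mat \<Rightarrow> complex vec set" where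
  "mat_range A \<equiv> vec_space.col_space (dim_row A) A"

definition mat_ind :: "complex mat \<Rightarrow> nat" where
  "mat_ind A = (LEAST k. mat_rank (A ^\<^sub>m (k + 1)) = mat_rank (A ^\<^sub>m k))"

definition minkowski_metric :: "nat \<Rightarrow> complex mat" where
  "minkowski_metric n = mat_diag n (\<lambda>i. if i = 0 then 1 else - 1)"

definition minkowski_adjoint :: "complex mat \<Rightarrow> complex mat" where
  "minkowski_adjoint A =
     minkowski_metric (dim_row A) * mat_adjoint A * minkowski_metric (dim_row A)"

definition is_drazin_inverse :: "complex mat \<Rightarrow> complex mat \<Rightarrow> bool" where
  "is_drazin_inverse A X \<longleftrightarrow>
     X \<in> carrier_mat (dim_row A) (dim_row A) \<and>
     X * A * X = X \<and> A * X = X * A \<and>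
     A ^\<^sub>m (mat_ind A + 1) * X = A ^\<^sub>m mat_ind A"

definition drazin_inverse :: "complex mat \<Rightarrow> complex mat" where
  "drazin_inverse A = (THE X. is_drazin_inverse A X)"

definition is_minkowski_inverse :: "complex mat \<Rightarrow> complex mat \<Rightarrow> bool" where
  "is_minkowski_inverse A X \<longleftrightarrow>
     X \<in> carrier_mat (dim_row A) (dim_row A) \<and>
     A * X * A = A \<and> X * A * X = X \<and>
     minkowski_adjoint (A * X) = A * X \<and> minkowski_adjoint (X * A) = X * A"

text \<open>A Minkowski inverse exists only when the ranks of \<open>A\<^sup>\<sim> A A\<^sup>\<sim>\<close> and \<open>A\<close> agree;
  otherwise the value below is unspecified.\<close>

definition minkowski_inverse :: "complex mat \<Rightarrow> complex mat" where
  "minkowski_inverse A = (THE X. is_minkowski_inverse A X)"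

definition m_DMP_inverse :: "complex mat \<Rightarrow> complex mat" where
  "m_DMP_inverse A = drazin_inverse A * A * minkowski_inverse A"

end

theory Submission
  imports Defs
begin

text \<open>The formula is Cramer's rule for the linear system \<open>(A\<^sup>k + E) x = A\<^sup>k A\<^sup>m b\<close>, where \<open>A\<^sup>m\<close> is the
  Minkowski inverse, \<open>A\<^sup>D\<close> the Drazin inverse and \<open>x = A\<^sup>D A A\<^sup>m b\<close>. This \<open>x\<close> solves the system:
  \<open>A\<^sup>k A\<^sup>D A = A\<^sup>k\<close> by the defining equations of the Drazin inverse, and \<open>E x = 0\<close> because the range
  of \<open>A\<^sup>D\<close> is contained in the range of \<open>A\<^sup>k\<close>, which is the null space of \<open>W\<close>.

  The system is nonsingular because at the index \<open>k\<close> the null space and the range of \<open>A\<^sup>k\<close> meet only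
  in zero (\<open>mat_kernel_range_pow_mat_ind\<close>). This makes \<open>W V\<close> invertible
  (\<open>det_mult_ne_0_of_complementary\<close>), turns \<open>E\<close> into a projection onto the null space of \<open>A\<^sup>k\<close> that kills
  its range, and so repairs exactly the defect of \<open>A\<^sup>k\<close> (\<open>det_add_projection_ne_0\<close>).

  Both generalized inverses are introduced by definite description, so their existence and
  uniqueness have to be shown. Existence rests on two consequences of equal ranks: if \<open>A B\<close> has
  the rank of \<open>A\<close>, then \<open>A\<close> factors as \<open>A B Y\<close> (\<open>factor_through_of_rank_mult_eq\<close>), and if it has
  the rank of \<open>B\<close>, then \<open>A B\<close> and \<open>B\<close> have the same null space
  (\<open>mat_kernel_eq_of_rank_mult_eq\<close>). For the Drazin inverse these apply to the powers of \<open>A\<close>, whose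
  ranks are constant from the index on. For the Minkowski inverse they apply to the adjoint \<open>H\<close> of
  \<open>A\<close> and the product \<open>H A H\<close>; the rank hypothesis compares that product with \<open>A\<close>, and
  \<open>rank_minkowski_adjoint\<close> makes it a comparison with \<open>H\<close>.\<close>

section \<open>Rank, null space and range\<close>

text \<open>A basis of the smaller space is linearly independent in the larger one and has as many
  elements as its dimension, so it spans the larger one too.\<close>
lemma (in vectorspace) subspace_eq_of_dim_eq:
  assumes X: "VectorSpace.subspace K X V" and Y: "VectorSpace.subspace K Y V" and XY: "X \<subseteq> Y"
    and fX: "vectorspace.fin_dim K (vs X)" and fY: "vectorspace.fin_dim K (vs Y)"
    and dim: "vectorspace.dim K (vs X) = vectorspace.dim K (vs Y)"
  shows "X = Y"
proof -
  interpret VX: vectorspace K "vs X" using X by (rule subspace_is_vs)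
  interpret VY: vectorspace K "vs Y" using Y by (rule subspace_is_vs)
  have subX: "submodule K X V" and subY: "submodule K Y V"
    using X Y by (auto simp: VectorSpace.subspace_def)
  obtain b where b: "finite b" "VX.basis b"
    using VX.finite_basis_exists[OF fX] by blast
  then have bX: "b \<subseteq> X" "VX.lin_indpt b" "VX.span b = X"
    by (auto simp: VX.basis_def)
  have li: "lin_indpt b" and sp: "span b = X"
    using span_li_not_depend[OF bX(1) subX] bX by auto
  have bY: "b \<subseteq> Y" using bX XY by auto
  have liY: "VY.lin_indpt b" and spY: "VY.span b = span b"
    using span_li_not_depend[OF bY subY] li by auto
  have "VY.basis b"
    by (rule VY.dim_li_is_basis[OF fY b(1) _ liY]) (use bY dim VX.dim_basis[OF b] in auto)
  then have "VY.span b = Y" by (simp add: VY.basis_def)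
  then show ?thesis using sp spY by simp
qed

lemma mat_kernel_subspace:
  assumes "A \<in> carrier_mat nr nc"
  shows "VectorSpace.subspace class_ring (mat_kernel A) (module_vec TYPE('a::field) nc)"
proof -
  interpret vec_space "TYPE('a)" nc .
  show ?thesis using assms
    by (auto simp: VectorSpace.subspace_def submodule_def mat_kernel mult_add_distrib_mat_vec mult_mat_vec vec_vs vec_module)
qed

lemma mat_kernel_fin_dim:
  assumes "A \<in> carrier_mat nr nc"
  shows "vectorspace.fin_dim class_ring ((module_vec TYPE('a::field) nc)\<lparr>carrier := mat_kernel A\<rparr>)"
proof -
  interpret kernel nr nc A using assms by unfold_locales
  show ?thesis
    using kernel_basis_exists[OF assms] unfolding Ker.fin_dim_def Ker.basis_def by auto
qed

lemma mult_mat_linear_map: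
  assumes "A \<in> carrier_mat nr nc"
  shows "linear_map class_ring (module_vec TYPE('a::field) nc) (module_vec TYPE('a) nr) (\<lambda>v. A *\<^sub>v v)"
proof -
  interpret C: vec_space "TYPE('a)" nc .
  interpret R: vec_space "TYPE('a)" nr .
  show ?thesis
    unfolding linear_map_def mod_hom_def mod_hom_axioms_def LinearCombinations.module_hom_def
    using assms
    by (auto simp: vec_vs vec_module mult_add_distrib_mat_vec mult_mat_vec)
qed

text \<open>The rank-nullity theorem for the linear map \<open>v \<mapsto> A v\<close>: its image is the column space of \<open>A\<close>.
  It turns every comparison of null spaces below into a comparison of ranks.\<close>
lemma rank_add_kernel_dim:
  assumes A: "A \<in> carrier_mat nr nc"
  shows "vec_space.rank nr (A :: 'a::field mat) + kernel_dim A = nc"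
proof -
  interpret C: vec_space "TYPE('a)" nc .
  interpret R: vec_space "TYPE('a)" nr .
  interpret kernel nr nc A using A by unfold_locales
  interpret L: linear_map class_ring "module_vec TYPE('a) nc" "module_vec TYPE('a) nr" "\<lambda>v. A *\<^sub>v v"
    using A by (rule mult_mat_linear_map)
  have im: "L.im = R.span (set (cols A))"
    using R.col_space_eq[OF A] A unfolding L.im_def R.col_space_def by auto
  have ker: "L.ker = mat_kernel A"
    using A unfolding L.ker_def by (auto simp: mat_kernel)
  show ?thesis using L.rank_nullity C.dim_is_n by (simp add: im ker R.rank_def)
qed

lemma (in vectorspace) subspace_dim_mono:
  assumes "VectorSpace.subspace K X V" "VectorSpace.subspace K Y V" "X \<subseteq> Y"
    and "vectorspace.fin_dim K (vs X)" "vectorspace.fin_dim K (vs Y)"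
  shows "vectorspace.dim K (vs X) \<le> vectorspace.dim K (vs Y)"
  using vectorspace.subspace_dim[OF subspace_is_vs[OF assms(2)] nested_subspaces[OF assms(2,1,3)]] assms(4,5)
  by simp

lemma rank_mult_le_right:
  assumes A: "A \<in> carrier_mat m k" and B: "B \<in> carrier_mat k n"
  shows "vec_space.rank m (A * (B :: 'a::field mat)) \<le> vec_space.rank k B"
proof -
  interpret vec_space "TYPE('a)" n .
  have AB: "A * B \<in> carrier_mat m n" using A B by simp
  have "kernel_dim B \<le> kernel_dim (A * B)"
    using subspace_dim_mono[OF mat_kernel_subspace[OF B] mat_kernel_subspace[OF AB]
        mat_kernel_mult_subset[OF B A] mat_kernel_fin_dim[OF B] mat_kernel_fin_dim[OF AB]] A B
    by (simp add: kernel_dim_def)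
  then show ?thesis
    using rank_add_kernel_dim[OF B] rank_add_kernel_dim[OF AB] by linarith
qed

text \<open>The null space of \<open>B\<close> always lies in that of \<open>A B\<close>; equality of the ranks forces the two
  nullities to agree.\<close>
lemma mat_kernel_eq_of_rank_mult_eq:
  assumes A: "A \<in> carrier_mat m k" and B: "B \<in> carrier_mat k n"
    and eq: "vec_space.rank m (A * (B :: 'a::field mat)) = vec_space.rank k B"
  shows "mat_kernel (A * B) = mat_kernel B"
proof -
  interpret vec_space "TYPE('a)" n .
  have AB: "A * B \<in> carrier_mat m n" using A B by simp
  have "kernel_dim B = kernel_dim (A * B)"
    using rank_add_kernel_dim[OF B] rank_add_kernel_dim[OF AB] eq by linarith
  then show ?thesis
    using subspace_eq_of_dim_eq[OF mat_kernel_subspace[OF B] mat_kernel_subspace[OF AB]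
        mat_kernel_mult_subset[OF B A] mat_kernel_fin_dim[OF B] mat_kernel_fin_dim[OF AB]] A B
    by (simp add: kernel_dim_def)
qed

lemma col_space_mult_subset:
  assumes A: "A \<in> carrier_mat m k" and B: "B \<in> carrier_mat k n"
  shows "vec_space.col_space m (A * (B :: 'a::field mat)) \<subseteq> vec_space.col_space m A"
proof -
  interpret vec_space "TYPE('a)" m .
  have AB: "A * B \<in> carrier_mat m n" using A B by simp
  show ?thesis
    unfolding col_space_eq[OF A] col_space_eq[OF AB] using A B
    by (auto intro!: bexI[of _ "B *\<^sub>v _"])
qed

lemma col_space_subspace:
  assumes A: "(A :: 'a::field mat) \<in> carrier_mat m n"
  shows "VectorSpace.subspace class_ring (vec_space.col_space m A) (module_vec TYPE('a) m)"
proof -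
  interpret vec_space "TYPE('a)" m .
  show ?thesis using A cols_dim[of A] unfolding col_space_def
    by (intro span_is_subspace) auto
qed

lemma col_space_fin_dim:
  assumes A: "(A :: 'a::field mat) \<in> carrier_mat m n"
  shows "vectorspace.fin_dim class_ring ((module_vec TYPE('a) m)\<lparr>carrier := vec_space.col_space m A\<rparr>)"
proof -
  interpret vec_space "TYPE('a)" m .
  show ?thesis unfolding col_space_def using A by (rule fin_dim_span_cols)
qed

lemma rank_mult_le_left:
  assumes A: "A \<in> carrier_mat m k" and B: "B \<in> carrier_mat k n"
  shows "vec_space.rank m (A * (B :: 'a::field mat)) \<le> vec_space.rank m A"
proof -
  interpret vec_space "TYPE('a)" m .
  have AB: "A * B \<in> carrier_mat m n" using A B by simp
  show ?thesis
    using subspace_dim_mono[OF col_space_subspace[OF AB] col_space_subspace[OF A]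
        col_space_mult_subset[OF A B] col_space_fin_dim[OF AB] col_space_fin_dim[OF A]]
    by (simp add: rank_def col_space_def)
qed

text \<open>The range of \<open>A B\<close> lies in that of \<open>A\<close>, so equal ranks make the ranges coincide. Each column
  of \<open>A\<close> is then the image under \<open>A B\<close> of some vector, and these vectors are the columns of \<open>Y\<close>.
  Both generalized inverses are built from factorizations of this kind.\<close>
lemma factor_through_of_rank_mult_eq:
  assumes A: "A \<in> carrier_mat m k" and B: "B \<in> carrier_mat k n"
    and eq: "vec_space.rank m (A * (B :: 'a::field mat)) = vec_space.rank m A"
  obtains Y where "Y \<in> carrier_mat n k" "A = A * B * Y"
proof -
  interpret vec_space "TYPE('a)" m .
  have AB: "A * B \<in> carrier_mat m n" using A B by simp
  have cs: "col_space (A * B) = col_space A"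
    using subspace_eq_of_dim_eq[OF col_space_subspace[OF AB] col_space_subspace[OF A]
        col_space_mult_subset[OF A B] col_space_fin_dim[OF AB] col_space_fin_dim[OF A]] eq
    by (simp add: rank_def col_space_def)
  have "\<exists>y. y \<in> carrier_vec n \<and> A * B *\<^sub>v y = col A j" if "j < k" for j
  proof -
    have "col A j = A *\<^sub>v unit_vec k j" using A that by (intro eq_vecI) auto
    then have "col A j \<in> col_space A"
      using A by (auto simp: col_space_eq[OF A] intro!: bexI[of _ "unit_vec k j"])
    then show ?thesis unfolding cs[symmetric] col_space_eq[OF AB] using AB B by auto
  qed
  then obtain y where y: "\<And>j. j < k \<Longrightarrow> y j \<in> carrier_vec n \<and> A * B *\<^sub>v y j = col A j" by metis
  define Y where "Y = mat_of_cols n (map y [0..<k])"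
  have Y: "Y \<in> carrier_mat n k"
    using mat_of_cols_carrier(1)[of n "map y [0..<k]"] by (simp add: Y_def)
  have "A = A * B * Y"
  proof (rule mat_col_eqI)
    fix j assume "j < dim_col (A * B * Y)"
    then have j: "j < k" using Y by simp
    have "col (A * B * Y) j = A * B *\<^sub>v col Y j" using col_mult2[OF AB Y j] .
    also have "col Y j = y j" using j y[OF j] by (simp add: Y_def)
    finally show "col A j = col (A * B * Y) j" using y[OF j] by simp
  qed (use A AB Y in auto)
  with Y that show thesis by blast
qed

lemma mult_mat_zero_vec:
  assumes "(A :: 'a::semiring_1 mat) \<in> carrier_mat m n"
  shows "A *\<^sub>v 0\<^sub>v n = 0\<^sub>v m"
  using assms by (intro eq_vecI) auto

text \<open>A left factor \<open>P\<close> of an equation may be exchanged for any \<open>Q\<close> with a larger null space,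
  because the columns of \<open>C - D\<close> lie in the null space of \<open>P\<close>.\<close>
lemma mult_eq_of_mat_kernel_subset:
  assumes P: "P \<in> carrier_mat m k" and Q: "Q \<in> carrier_mat l k"
    and C: "C \<in> carrier_mat k n" and D: "D \<in> carrier_mat k n"
    and sub: "mat_kernel P \<subseteq> mat_kernel (Q :: 'a::field mat)" and eq: "P * C = P * D"
  shows "Q * C = Q * D"
proof (rule mat_col_eqI)
  fix j assume "j < dim_col (Q * D)"
  then have j: "j < n" using D by simp
  have c: "col C j \<in> carrier_vec k" "col D j \<in> carrier_vec k" using C D j by auto
  have "P *\<^sub>v col C j = P *\<^sub>v col D j"
    using arg_cong[OF eq, of "\<lambda>M. col M j"] by (simp add: col_mult2[OF P C j] col_mult2[OF P D j])
  then have "col C j - col D j \<in> mat_kernel P"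
    using P c by (intro mat_kernelI[OF P]) (auto simp: mult_minus_distrib_mat_vec)
  then have "Q *\<^sub>v (col C j - col D j) = 0\<^sub>v l" using sub mat_kernelD[OF Q] by auto
  then have z: "Q *\<^sub>v col C j - Q *\<^sub>v col D j = 0\<^sub>v l" using Q c by (simp add: mult_minus_distrib_mat_vec)
  have "Q *\<^sub>v col C j = Q *\<^sub>v col D j"
  proof (rule eq_vecI)
    fix i assume "i < dim_vec (Q *\<^sub>v col D j)"
    then show "(Q *\<^sub>v col C j) $ i = (Q *\<^sub>v col D j) $ i"
      using arg_cong[OF z, of "\<lambda>v. v $ i"] Q by simp
  qed (use Q in auto)
  then show "col (Q * C) j = col (Q * D) j"
    by (simp add: col_mult2[OF Q C j] col_mult2[OF Q D j])
qed (use Q C D in auto)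

section \<open>The Minkowski adjoint\<close>
lemma mat_adjoint_dim [simp]:
  "dim_row (mat_adjoint A) = dim_col A" "dim_col (mat_adjoint A) = dim_row A"
  by (simp_all add: mat_adjoint_def)

lemma mat_adjoint_carrier [simp]:
  "A \<in> carrier_mat m n \<Longrightarrow> mat_adjoint A \<in> carrier_mat n m"
  by (auto simp: mat_adjoint_def)

lemma mat_adjoint_index [simp]:
  assumes "A \<in> carrier_mat m n" "i < n" "j < m"
  shows "mat_adjoint A $$ (i, j) = conjugate (A $$ (j, i))"
  using assms by (auto simp: mat_adjoint_def mat_of_rows_index)

lemma adjoint_scalar_prod:
  fixes A :: "complex mat"
  assumes A: "A \<in> carrier_mat m n" and v: "v \<in> carrier_vec n" and w: "w \<in> carrier_vec m"
  shows "(A *\<^sub>v v) \<bullet>c w = v \<bullet>c (mat_adjoint A *\<^sub>v w)"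
proof -
  have "(A *\<^sub>v v) \<bullet>c w = (\<Sum>i<m. \<Sum>j<n. A $$ (i, j) * v $ j * cnj (w $ i))"
    using A v w by (auto simp: scalar_prod_def sum_distrib_right atLeast0LessThan intro!: sum.cong)
  also have "\<dots> = (\<Sum>j<n. \<Sum>i<m. A $$ (i, j) * v $ j * cnj (w $ i))"
    by (rule sum.swap)
  also have "\<dots> = v \<bullet>c (mat_adjoint A *\<^sub>v w)"
    using A v w
    by (auto simp: scalar_prod_def sum_distrib_left atLeast0LessThan cnj_sum ac_simps intro!: sum.cong)
  finally show ?thesis .
qed

text \<open>If \<open>A\<^sup>* A v = 0\<close> then the squared norm of \<open>A v\<close> equals the inner product of \<open>v\<close> with
  \<open>A\<^sup>* A v\<close> and vanishes. This uses the Euclidean adjoint; the Minkowski form is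
  indefinite, so the same argument fails for the Minkowski adjoint.\<close>
lemma mat_kernel_adjoint_mult:
  fixes A :: "complex mat"
  assumes A: "A \<in> carrier_mat m n"
  shows "mat_kernel (mat_adjoint A * A) = mat_kernel A"
proof
  have B: "mat_adjoint A * A \<in> carrier_mat n n"
    by (rule mult_carrier_mat[OF mat_adjoint_carrier[OF A] A])
  show "mat_kernel A \<subseteq> mat_kernel (mat_adjoint A * A)"
    by (rule mat_kernel_mult_subset[OF A mat_adjoint_carrier[OF A]])
  show "mat_kernel (mat_adjoint A * A) \<subseteq> mat_kernel A"
  proof
    fix v assume "v \<in> mat_kernel (mat_adjoint A * A)"
    then have v: "v \<in> carrier_vec n" and z: "mat_adjoint A * A *\<^sub>v v = 0\<^sub>v n"
      using mat_kernelD[OF B] by auto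
    have Av: "A *\<^sub>v v \<in> carrier_vec m" using A v by simp
    have "(A *\<^sub>v v) \<bullet>c (A *\<^sub>v v) = v \<bullet>c (mat_adjoint A * A *\<^sub>v v)"
      unfolding adjoint_scalar_prod[OF A v Av] assoc_mult_mat_vec[OF mat_adjoint_carrier[OF A] A v] ..
    also have "\<dots> = 0" using z v by simp
    finally have "A *\<^sub>v v = 0\<^sub>v m" using conjugate_square_eq_0_vec[OF Av] by simp
    then show "v \<in> mat_kernel A" using A v by (auto intro: mat_kernelI)
  qed
qed

lemma rank_le_rank_adjoint:
  fixes A :: "complex mat"
  assumes A: "A \<in> carrier_mat m n"
  shows "vec_space.rank m A \<le> vec_space.rank n (mat_adjoint A)"
proof -
  have A': "mat_adjoint A \<in> carrier_mat n m" using A by simp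
  have "kernel_dim (mat_adjoint A * A) = kernel_dim A"
    using A by (simp add: kernel_dim_def mat_kernel_adjoint_mult[OF A])
  then have "vec_space.rank m A = vec_space.rank n (mat_adjoint A * A)"
    using rank_add_kernel_dim[OF A] rank_add_kernel_dim[OF mult_carrier_mat[OF A' A]] by linarith
  also have "\<dots> \<le> vec_space.rank n (mat_adjoint A)" by (rule rank_mult_le_left[OF A' A])
  finally show ?thesis .
qed

lemma minkowski_metric_carrier [simp]: "minkowski_metric n \<in> carrier_mat n n"
  by (simp add: minkowski_metric_def mat_diag_dim)

lemma minkowski_metric_dim [simp]:
  "dim_row (minkowski_metric n) = n" "dim_col (minkowski_metric n) = n"
  by (rule carrier_matD[OF minkowski_metric_carrier])+

lemma minkowski_metric_involutive: "minkowski_metric n * minkowski_metric n = 1\<^sub>m n"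
  unfolding minkowski_metric_def mat_diag_diag mat_diag_one[symmetric]
  by (rule arg_cong[of _ _ "mat_diag n"]) auto

lemma minkowski_adjoint_dim [simp]:
  "dim_row (minkowski_adjoint A) = dim_row A" "dim_col (minkowski_adjoint A) = dim_row A"
  by (simp_all add: minkowski_adjoint_def)

lemma minkowski_adjoint_carrier [simp]:
  "A \<in> carrier_mat n n \<Longrightarrow> minkowski_adjoint A \<in> carrier_mat n n"
  by auto

lemma minkowski_adjoint_index:
  assumes A: "A \<in> carrier_mat n n" and ij: "i < n" "j < n"
  shows "minkowski_adjoint A $$ (i, j) =
    (if i = 0 then 1 else - 1) * cnj (A $$ (j, i)) * (if j = 0 then 1 else - 1)"
proof -
  have "minkowski_metric n * mat_adjoint A \<in> carrier_mat n n"
    by (rule mult_carrier_mat[OF minkowski_metric_carrier mat_adjoint_carrier[OF A]])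
  then show ?thesis
    using A ij unfolding minkowski_adjoint_def minkowski_metric_def
    by (simp add: mat_diag_mult_left[OF mat_adjoint_carrier[OF A]] mat_diag_mult_right[of _ n n])
qed

lemma minkowski_adjoint_mult:
  assumes A: "A \<in> carrier_mat n n" and B: "B \<in> carrier_mat n n"
  shows "minkowski_adjoint (A * B) = minkowski_adjoint B * minkowski_adjoint A"
proof (rule eq_matI)
  have A': "minkowski_adjoint A \<in> carrier_mat n n" and B': "minkowski_adjoint B \<in> carrier_mat n n"
    and AB: "A * B \<in> carrier_mat n n" using A B by auto
  fix i j
  assume "i < dim_row (minkowski_adjoint B * minkowski_adjoint A)"
    and "j < dim_col (minkowski_adjoint B * minkowski_adjoint A)"
  then have ij: "i < n" "j < n" using A' B' by auto
  show "minkowski_adjoint (A * B) $$ (i, j) = (minkowski_adjoint B * minkowski_adjoint A) $$ (i, j)"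
    using A B A' B' ij
    by (auto simp: minkowski_adjoint_index[OF AB] row_def col_def minkowski_adjoint_index[OF A]
        minkowski_adjoint_index[OF B] scalar_prod_def cnj_sum sum_distrib_left sum_negf[symmetric]
        intro!: sum.cong)
next
  show "dim_row (minkowski_adjoint (A * B)) = dim_row (minkowski_adjoint B * minkowski_adjoint A)"
    "dim_col (minkowski_adjoint (A * B)) = dim_col (minkowski_adjoint B * minkowski_adjoint A)"
    using A B by auto
qed

lemma minkowski_adjoint_involutive:
  assumes A: "A \<in> carrier_mat n n"
  shows "minkowski_adjoint (minkowski_adjoint A) = A"
proof (rule eq_matI)
  fix i j assume "i < dim_row A" "j < dim_col A"
  then show "minkowski_adjoint (minkowski_adjoint A) $$ (i, j) = A $$ (i, j)"
    using A by (simp add: minkowski_adjoint_index[OF minkowski_adjoint_carrier[OF A]]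
        minkowski_adjoint_index[OF A])
qed (use A in auto)

text \<open>The metric is invertible, so the Minkowski adjoint and the conjugate transpose have the same
  rank, which is at least that of the matrix. Applying the resulting inequality also to the adjoint
  and using that the adjoint is an involution gives equality.\<close>
lemma rank_minkowski_adjoint:
  assumes A: "A \<in> carrier_mat n n"
  shows "vec_space.rank n (minkowski_adjoint A) = vec_space.rank n A"
proof -
  have le: "vec_space.rank n B \<le> vec_space.rank n (minkowski_adjoint B)"
    if B: "B \<in> carrier_mat n n" for B
  proof -
    let ?G = "minkowski_metric n" and ?H = "minkowski_adjoint B"
    have G: "?G \<in> carrier_mat n n" and H: "?H \<in> carrier_mat n n"
      and B': "mat_adjoint B \<in> carrier_mat n n" using B by auto
    have "?G * ?H * ?G = ?G * (?G * mat_adjoint B * ?G) * ?G"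
      using B by (simp add: minkowski_adjoint_def)
    also have "\<dots> = (?G * ?G) * mat_adjoint B * (?G * ?G)"
      using assoc_mult_mat[OF mult_carrier_mat[OF G mult_carrier_mat[OF G B']] G G]
        assoc_mult_mat[OF G mult_carrier_mat[OF G B'] G] assoc_mult_mat[OF G G B'] by simp
    also have "\<dots> = mat_adjoint B"
      using left_mult_one_mat[OF B'] right_mult_one_mat[OF B'] by (simp add: minkowski_metric_involutive)
    finally have eq: "mat_adjoint B = ?G * ?H * ?G" by simp
    have "vec_space.rank n B \<le> vec_space.rank n (?G * ?H * ?G)"
      using rank_le_rank_adjoint[OF B] eq by simp
    also have "\<dots> \<le> vec_space.rank n (?G * ?H)"
      by (rule rank_mult_le_left[OF mult_carrier_mat[OF G H] G])
    also have "\<dots> \<le> vec_space.rank n ?H" by (rule rank_mult_le_right[OF G H])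
    finally show ?thesis .
  qed
  show ?thesis
    using le[OF A] le[OF minkowski_adjoint_carrier[OF A]] minkowski_adjoint_involutive[OF A] by simp
qed

section \<open>The Minkowski inverse\<close>

text \<open>Write \<open>H\<close> for the Minkowski adjoint of \<open>A\<close>. The hypothesis says that \<open>H A H\<close> has the rank of
  \<open>H\<close>. Equality of the ranges gives \<open>H = H A H Y\<close>, and the inverse is \<open>M = H Y\<close>. Thus
  \<open>H A M = H\<close> at once, while equality of the null spaces yields \<open>M A H = H\<close>. Taking
  adjoints of these two identities gives \<open>(A M)\<^sup>\<sim> A = A\<close> and \<open>A (M A)\<^sup>\<sim> = A\<close>, so that \<open>A M\<close> and
  \<open>M A\<close> are products of a matrix with its own adjoint, hence self-adjoint.\<close>
lemma minkowski_inverse_exists: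
  assumes A: "A \<in> carrier_mat n n"
    and rank: "mat_rank (minkowski_adjoint A * A * minkowski_adjoint A) = mat_rank A"
  shows "\<exists>X. is_minkowski_inverse A X"
proof -
  define H where "H = minkowski_adjoint A"
  have H: "H \<in> carrier_mat n n" using A by (simp add: H_def)
  note assoc = assoc_mult_mat[of _ n n _ n _ n]
  have HA: "H * A \<in> carrier_mat n n" and AH: "A * H \<in> carrier_mat n n" using A H by auto
  have rk: "vec_space.rank n (H * (A * H)) = vec_space.rank n H"
    "vec_space.rank n (H * A * H) = vec_space.rank n H"
    using rank A H rank_minkowski_adjoint[OF A] by (auto simp: H_def[symmetric] assoc)
  obtain Y where Y: "Y \<in> carrier_mat n n" and HY: "H = H * (A * H) * Y"
    using factor_through_of_rank_mult_eq[OF H AH rk(1)] .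
  define M where "M = H * Y"
  have M: "M \<in> carrier_mat n n" using H Y by (simp add: M_def)
  have "H * (A * M) = H * (A * H) * Y" using H A Y by (simp add: M_def assoc)
  then have HAM: "H * (A * M) = H" by (simp only: HY[symmetric])
  have ker: "mat_kernel (H * A * H) = mat_kernel H"
    by (rule mat_kernel_eq_of_rank_mult_eq[OF HA H rk(2)])
  (* Y A H and the identity agree after multiplication by H A H, whose null space is that of H. *)
  have "H * (Y * A * H) = H * 1\<^sub>m n"
  proof (rule mult_eq_of_mat_kernel_subset[OF _ H])
    show "mat_kernel (H * A * H) \<subseteq> mat_kernel H" using ker by simp
    have "H * A * H * (Y * A * H) = H * (A * H) * Y * (A * H)"
      using H A Y by (simp add: assoc)
    also have "\<dots> = H * A * H * 1\<^sub>m n" using H A by (simp add: HY[symmetric] assoc)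
    finally show "H * A * H * (Y * A * H) = H * A * H * 1\<^sub>m n" .
  qed (use H A Y in auto)
  then have MAH: "M * (A * H) = H" using H A Y by (simp add: M_def assoc)
  have H': "minkowski_adjoint H = A" using minkowski_adjoint_involutive[OF A] by (simp add: H_def)
  have AM: "A * M \<in> carrier_mat n n" and MA: "M * A \<in> carrier_mat n n" using A M by auto
  have 1: "minkowski_adjoint (A * M) * A = A"
    using arg_cong[OF HAM, of minkowski_adjoint] by (simp add: minkowski_adjoint_mult[OF H AM] H')
  have 2: "A * minkowski_adjoint (M * A) = A"
  proof -
    have "M * A * H = H" using MAH A M H by (simp add: assoc)
    from arg_cong[OF this, of minkowski_adjoint] show ?thesis
      by (simp add: minkowski_adjoint_mult[OF MA H] H')
  qed
  have AM': "minkowski_adjoint (A * M) \<in> carrier_mat n n"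
    and MA': "minkowski_adjoint (M * A) \<in> carrier_mat n n" using AM MA by auto
  have "minkowski_adjoint (A * M) * (A * M) = A * M"
    using 1 A M AM' by (simp add: assoc[symmetric])
  then have s1: "minkowski_adjoint (A * M) = A * M"
    using minkowski_adjoint_mult[OF AM' AM] minkowski_adjoint_involutive[OF AM] by metis
  have "(M * A) * minkowski_adjoint (M * A) = M * A"
    using 2 A M MA' by (simp add: assoc)
  then have s2: "minkowski_adjoint (M * A) = M * A"
    using minkowski_adjoint_mult[OF MA MA'] minkowski_adjoint_involutive[OF MA] by metis
  have "M * A * M = M * A * (H * Y)" by (simp only: M_def)
  also have "\<dots> = M * (A * H) * Y" using A M H Y by (simp add: assoc)
  also have "\<dots> = M" by (simp only: MAH M_def[symmetric])
  finally have "M * A * M = M" .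
  then have "is_minkowski_inverse A M"
    unfolding is_minkowski_inverse_def using A M 1 s1 s2 by auto
  then show ?thesis by blast
qed

text \<open>As for the Moore-Penrose inverse, \<open>A X = (A Y) (A X)\<close> is a product of self-adjoint matrices;
  reversing the factors by taking adjoints collapses it to \<open>A Y\<close>. Likewise \<open>X A = Y A\<close>.\<close>
lemma minkowski_inverse_unique:
  assumes A: "A \<in> carrier_mat n n"
    and X: "is_minkowski_inverse A X" and Y: "is_minkowski_inverse A Y"
  shows "X = Y"
proof -
  note assoc = assoc_mult_mat[of _ n n _ n _ n]
  have Xc: "X \<in> carrier_mat n n" and Yc: "Y \<in> carrier_mat n n"
    using A X Y by (auto simp: is_minkowski_inverse_def)
  have AX: "A * X \<in> carrier_mat n n" and AY: "A * Y \<in> carrier_mat n n"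
    and XA: "X * A \<in> carrier_mat n n" and YA: "Y * A \<in> carrier_mat n n" using A Xc Yc by auto
  have x: "A * X * A = A" "X * A * X = X"
      "minkowski_adjoint (A * X) = A * X" "minkowski_adjoint (X * A) = X * A"
    and y: "A * Y * A = A" "Y * A * Y = Y"
      "minkowski_adjoint (A * Y) = A * Y" "minkowski_adjoint (Y * A) = Y * A"
    using X Y by (auto simp: is_minkowski_inverse_def)
  have "A * X = minkowski_adjoint ((A * Y) * (A * X))"
    using y(1) x(3) assoc[OF AY A Xc] by simp
  also have "\<dots> = (A * X) * (A * Y)" by (simp only: minkowski_adjoint_mult[OF AY AX] x(3) y(3))
  also have "\<dots> = A * Y" using x(1) assoc[OF AX A Yc] by simp
  finally have eq1: "A * X = A * Y" .
  have "X * A = minkowski_adjoint ((X * A) * (Y * A))"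
    using y(1) x(4) assoc[OF Xc A YA] assoc[OF A Yc A] by simp
  also have "\<dots> = (Y * A) * (X * A)" by (simp only: minkowski_adjoint_mult[OF XA YA] x(4) y(4))
  also have "\<dots> = Y * A" using x(1) assoc[OF Yc A XA] assoc[OF A Xc A] by simp
  finally have eq2: "X * A = Y * A" .
  have "X = Y * (A * X)" using x(2) assoc[OF Yc A Xc] by (simp only: eq2)
  also have "\<dots> = Y * A * Y" by (simp only: eq1 assoc[OF Yc A Yc])
  finally show ?thesis by (simp only: y(2))
qed

lemma is_minkowski_inverse_minkowski_inverse:
  assumes "A \<in> carrier_mat n n"
    and "mat_rank (minkowski_adjoint A * A * minkowski_adjoint A) = mat_rank A"
  shows "is_minkowski_inverse A (minkowski_inverse A)"
proof -
  obtain X where X: "is_minkowski_inverse A X" using minkowski_inverse_exists[OF assms] by blast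
  show ?thesis
    unfolding minkowski_inverse_def by (rule theI[of "is_minkowski_inverse A", OF X minkowski_inverse_unique[OF assms(1) _ X]])
qed

section \<open>Powers of a matrix at its index\<close>
lemma pow_mat_add:
  assumes A: "(A :: 'a::semiring_1 mat) \<in> carrier_mat n n"
  shows "A ^\<^sub>m (i + j) = A ^\<^sub>m i * A ^\<^sub>m j"
proof (induction j)
  case (Suc j)
  then show ?case using A by (simp add: assoc_mult_mat[of _ n n _ n _ n])
qed (use A in simp)

text \<open>The defining equation of the index has a solution: otherwise the ranks of the powers of \<open>A\<close>
  would decrease strictly forever.\<close>
lemma rank_pow_mat_ind:
  assumes A: "A \<in> carrier_mat n n"
  shows "vec_space.rank n (A ^\<^sub>m (mat_ind A + 1)) = vec_space.rank n (A ^\<^sub>m mat_ind A)"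
proof -
  let ?r = "\<lambda>k. vec_space.rank n (A ^\<^sub>m k)"
  have "\<exists>k. ?r (k + 1) = ?r k"
  proof (rule ccontr)
    assume neq: "\<nexists>k. ?r (k + 1) = ?r k"
    have step: "?r (k + 1) < ?r k" for k
      using rank_mult_le_left[OF pow_carrier_mat[OF A] A, of k] neq[simplified, rule_format, of k] A
      by simp
    have "?r k + k \<le> ?r 0" for k
    proof (induction k)
      case (Suc k)
      then show ?case using step[of k] by simp
    qed simp
    from this[of "?r 0 + 1"] show False by simp
  qed
  then show ?thesis
    using LeastI_ex[of "\<lambda>k. ?r (k + 1) = ?r k"] A unfolding mat_ind_def by simp
qed

text \<open>With \<open>k\<close> the index, \<open>A\<^sup>k = A\<^sup>k A Y\<close> for some \<open>Y\<close>. Multiplying by \<open>A\<^sup>m\<close> lets one extract one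
  more factor \<open>A\<close>, so the range of \<open>A\<^sup>k\<close> lies in that of every higher power.\<close>
lemma pow_mat_ind_factor:
  assumes A: "A \<in> carrier_mat n n"
  shows "\<exists>S \<in> carrier_mat n n. A ^\<^sub>m mat_ind A = A ^\<^sub>m (mat_ind A + m) * S"
proof (induction m)
  case 0
  show ?case using A by (intro bexI[of _ "1\<^sub>m n"]) simp_all
next
  case (Suc m)
  let ?k = "mat_ind A"
  note assoc = assoc_mult_mat[of _ n n _ n _ n]
  have P: "A ^\<^sub>m ?k \<in> carrier_mat n n" "A ^\<^sub>m m \<in> carrier_mat n n" using A by auto
  from Suc obtain S where S: "S \<in> carrier_mat n n" "A ^\<^sub>m ?k = A ^\<^sub>m (?k + m) * S" by blast
  have "vec_space.rank n (A ^\<^sub>m ?k * A) = vec_space.rank n (A ^\<^sub>m ?k)"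
    using rank_pow_mat_ind[OF A] by simp
  then obtain Y where Y: "Y \<in> carrier_mat n n" "A ^\<^sub>m ?k = A ^\<^sub>m ?k * A * Y"
    by (rule factor_through_of_rank_mult_eq[OF P(1) A])
  have "A ^\<^sub>m (?k + m) = A ^\<^sub>m m * A ^\<^sub>m ?k"
    using pow_mat_add[OF A, of m ?k] by (simp only: add.commute)
  also have "\<dots> = A ^\<^sub>m m * (A ^\<^sub>m ?k * A * Y)" by (simp only: Y(2)[symmetric])
  also have "\<dots> = A ^\<^sub>m (m + Suc ?k) * Y"
    unfolding pow_mat_add[OF A, of m "Suc ?k"] pow_mat.simps
    by (rule assoc[OF P(2) mult_carrier_mat[OF P(1) A] Y(1), symmetric])
  also have "m + Suc ?k = ?k + Suc m" by simp
  finally have "A ^\<^sub>m (?k + m) * S = A ^\<^sub>m (?k + Suc m) * (Y * S)"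
    by (simp only: assoc[OF pow_carrier_mat[OF A] Y(1) S(1)])
  then show ?case using S(2) mult_carrier_mat[OF Y(1) S(1)] by metis
qed

lemma mat_kernel_pow_mat_ind:
  assumes A: "A \<in> carrier_mat n n"
  shows "mat_kernel (A ^\<^sub>m (mat_ind A + m)) = mat_kernel (A ^\<^sub>m mat_ind A)"
proof -
  let ?k = "mat_ind A"
  have P: "A ^\<^sub>m i \<in> carrier_mat n n" for i using A by simp
  obtain S where S: "S \<in> carrier_mat n n" "A ^\<^sub>m ?k = A ^\<^sub>m (?k + m) * S"
    using pow_mat_ind_factor[OF A] by blast
  have comm: "A ^\<^sub>m (?k + m) = A ^\<^sub>m m * A ^\<^sub>m ?k"
    by (metis pow_mat_add[OF A] add.commute)
  have "vec_space.rank n (A ^\<^sub>m (?k + m)) = vec_space.rank n (A ^\<^sub>m ?k)"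
    using rank_mult_le_left[OF P S(1), of "?k + m", folded S(2)]
      rank_mult_le_right[OF P P, of m ?k, folded comm] by (rule antisym[rotated])
  then show ?thesis using mat_kernel_eq_of_rank_mult_eq[OF P P, of m ?k, folded comm] by blast
qed

text \<open>A vector \<open>A\<^sup>k u\<close> killed by \<open>A\<^sup>k\<close> has \<open>A\<^bsup>2k\<^esup> u = 0\<close>, and the null space no longer grows beyond
  the index, so already \<open>A\<^sup>k u = 0\<close>. This complementarity is the reason why \<open>W V\<close> is invertible.\<close>
lemma mat_kernel_range_pow_mat_ind:
  assumes A: "A \<in> carrier_mat n n"
    and ker: "v \<in> mat_kernel (A ^\<^sub>m mat_ind A)" and range: "v \<in> mat_range (A ^\<^sub>m mat_ind A)"
  shows "v = 0\<^sub>v n"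
proof -
  interpret vec_space "TYPE(complex)" n .
  let ?k = "mat_ind A"
  have P: "A ^\<^sub>m i \<in> carrier_mat n n" for i using A by simp
  obtain u where u: "u \<in> carrier_vec n" "v = A ^\<^sub>m ?k *\<^sub>v u"
    using range col_space_eq[OF P, of ?k] carrier_matD[OF P, of ?k] by auto
  have "A ^\<^sub>m (?k + ?k) *\<^sub>v u = 0\<^sub>v n"
    using mat_kernelD[OF P ker] u by (simp add: pow_mat_add[OF A] assoc_mult_mat_vec[OF P P])
  then have "u \<in> mat_kernel (A ^\<^sub>m (?k + ?k))" using u by (intro mat_kernelI[OF P])
  then show ?thesis using mat_kernelD[OF P] u by (simp add: mat_kernel_pow_mat_ind[OF A])
qed

section \<open>The Drazin inverse\<close>

text \<open>Choose \<open>S\<close> with \<open>A\<^sup>k = A\<^bsup>2k+1\<^esup> S\<close> and put \<open>X = A\<^sup>k S\<close>; then \<open>A\<^bsup>k+1\<^esup> X = A\<^sup>k\<close> by construction.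
  Although \<open>S\<close> need not commute with \<open>A\<close>, the matrices \<open>A S\<close> and \<open>S A\<close> agree after
  multiplication by \<open>A\<^bsup>2k+1\<^esup>\<close>, hence after multiplication by \<open>A\<^sup>k\<close>, which has the same null
  space. So \<open>X\<close> commutes with \<open>A\<close>, and \<open>X A X = A\<^bsup>k+1\<^esup> X S = X\<close>.\<close>
lemma drazin_inverse_exists:
  assumes A: "A \<in> carrier_mat n n"
  shows "\<exists>X. is_drazin_inverse A X"
proof -
  define k where "k = mat_ind A"
  note assoc = assoc_mult_mat[of _ n n _ n _ n]
  have P: "A ^\<^sub>m i \<in> carrier_mat n n" for i using A by simp
  have comm: "A * A ^\<^sub>m i = A ^\<^sub>m i * A" for i
    using pow_mat_add[OF A, of 1 i] A by simp
  obtain S where S: "S \<in> carrier_mat n n" "A ^\<^sub>m k = A ^\<^sub>m (k + (k + 1)) * S"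
    using pow_mat_ind_factor[OF A, of "mat_ind A + 1"] unfolding k_def by blast
  define X where "X = A ^\<^sub>m k * S"
  have X: "X \<in> carrier_mat n n" unfolding X_def by (rule mult_carrier_mat[OF P S(1)])
  have inv: "A ^\<^sub>m (k + 1) * X = A ^\<^sub>m k"
  proof -
    have "A ^\<^sub>m (k + 1) * X = A ^\<^sub>m (k + 1 + k) * S"
      unfolding X_def pow_mat_add[OF A, of "k + 1" k] by (rule assoc[OF P P S(1), symmetric])
    also have "k + 1 + k = k + (k + 1)" by simp
    finally show ?thesis by (simp only: S(2)[symmetric])
  qed
  have "A ^\<^sub>m (k + (k + 1)) * (A * S) = A ^\<^sub>m (k + (k + 1)) * (S * A)"
  proof -
    have "A ^\<^sub>m (k + (k + 1)) * (A * S) = A * (A ^\<^sub>m (k + (k + 1)) * S)"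
      by (simp only: assoc[OF P A S(1), symmetric] assoc[OF A P S(1), symmetric] comm)
    also have "\<dots> = A ^\<^sub>m k * A" by (simp only: S(2)[symmetric] comm)
    also have "\<dots> = A ^\<^sub>m (k + (k + 1)) * S * A" by (simp only: S(2)[symmetric])
    also have "\<dots> = A ^\<^sub>m (k + (k + 1)) * (S * A)" by (rule assoc[OF P S(1) A])
    finally show ?thesis .
  qed
  then have "A ^\<^sub>m k * (A * S) = A ^\<^sub>m k * (S * A)"
  proof (rule mult_eq_of_mat_kernel_subset[OF P P mult_carrier_mat[OF A S(1)] mult_carrier_mat[OF S(1) A], rotated])
    show "mat_kernel (A ^\<^sub>m (k + (k + 1))) \<subseteq> mat_kernel (A ^\<^sub>m k)"
      unfolding k_def mat_kernel_pow_mat_ind[OF A] ..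
  qed
  then have AX: "A * X = X * A"
    unfolding X_def by (simp only: assoc[OF A P S(1), symmetric] assoc[OF P S(1) A] assoc[OF P A S(1)] comm)
  have pX: "A ^\<^sub>m i * X = X * A ^\<^sub>m i" for i
  proof (induction i)
    case (Suc i)
    have "A ^\<^sub>m i * A * X = A ^\<^sub>m i * X * A"
      by (simp only: assoc[OF P A X] assoc[OF P X A] AX)
    also have "\<dots> = X * (A ^\<^sub>m i * A)" by (simp only: Suc assoc[OF X P A])
    finally show ?case by simp
  qed (use A X in simp)
  have "X * A * X = X * (A * X)" by (rule assoc[OF X A X])
  also have "\<dots> = X * (A ^\<^sub>m (k + 1) * S)"
    by (simp only: X_def assoc[OF A P S(1), symmetric] comm) simp
  also have "\<dots> = A ^\<^sub>m (k + 1) * X * S" by (simp only: pX assoc[OF X P S(1)])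
  also have "\<dots> = X" by (simp only: inv) (simp only: X_def)
  finally have "is_drazin_inverse A X"
    unfolding is_drazin_inverse_def using A X AX inv by (auto simp: k_def)
  then show ?thesis by blast
qed

text \<open>From \<open>X = A X X\<close> one can split off a factor \<open>A\<close> on the left as often as desired.\<close>
lemma drazin_inverse_factor:
  assumes A: "A \<in> carrier_mat n n" and X: "is_drazin_inverse A X"
  shows "\<exists>C \<in> carrier_mat n n. X = A ^\<^sub>m i * C"
proof (induction i)
  have Xc: "X \<in> carrier_mat n n" and xax: "X * A * X = X" and com: "A * X = X * A"
    using X A by (auto simp: is_drazin_inverse_def)
  {
    case 0
    show ?case using A Xc by (intro bexI[of _ X]) simp_all
  next
    case (Suc i)
    note assoc = assoc_mult_mat[of _ n n _ n _ n]
    have P: "A ^\<^sub>m i \<in> carrier_mat n n" using A by simp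
    from Suc obtain C where C: "C \<in> carrier_mat n n" "X = A ^\<^sub>m i * C" by blast
    have pow_comm: "A * A ^\<^sub>m i = A ^\<^sub>m i * A"
      using pow_mat_add[OF A, of 1 i] A by simp
    have "X = A * X * X" by (simp only: com xax)
    also have "\<dots> = A * (A ^\<^sub>m i * C) * X" by (simp only: C(2)[symmetric])
    also have "\<dots> = A * A ^\<^sub>m i * (C * X)"
      by (simp only: assoc[OF A P C(1), symmetric] assoc[OF mult_carrier_mat[OF A P] C(1) Xc])
    also have "\<dots> = A ^\<^sub>m Suc i * (C * X)" by (simp add: pow_comm)
    finally show ?case using mult_carrier_mat[OF C(1) Xc] by blast
  }
qed

text \<open>Two Drazin inverses \<open>A\<^sup>k C\<close> and \<open>A\<^sup>k D\<close> agree after multiplication by \<open>A\<^bsup>k+1\<^esup>\<close>, so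
  \<open>A\<^bsup>2k+1\<^esup> C = A\<^bsup>2k+1\<^esup> D\<close>. Since \<open>A\<^bsup>2k+1\<^esup>\<close> and \<open>A\<^sup>k\<close> have the same null space, they are equal.\<close>
lemma drazin_inverse_unique:
  assumes A: "A \<in> carrier_mat n n"
    and X: "is_drazin_inverse A X" and Y: "is_drazin_inverse A Y"
  shows "X = Y"
proof -
  define k where "k = mat_ind A"
  note assoc = assoc_mult_mat[of _ n n _ n _ n]
  have P: "A ^\<^sub>m i \<in> carrier_mat n n" for i using A by simp
  obtain C where C: "C \<in> carrier_mat n n" "X = A ^\<^sub>m k * C" using drazin_inverse_factor[OF A X] by blast
  obtain D where D: "D \<in> carrier_mat n n" "Y = A ^\<^sub>m k * D" using drazin_inverse_factor[OF A Y] by blast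
  have "A ^\<^sub>m (k + 1) * X = A ^\<^sub>m (k + 1) * Y"
    using X Y by (simp add: is_drazin_inverse_def k_def)
  then have eq: "A ^\<^sub>m (k + 1 + k) * C = A ^\<^sub>m (k + 1 + k) * D"
    unfolding C(2) D(2) pow_mat_add[OF A, of "k + 1" k] assoc[OF P P C(1)] assoc[OF P P D(1)] .
  have "mat_kernel (A ^\<^sub>m (k + 1 + k)) \<subseteq> mat_kernel (A ^\<^sub>m k)"
    using mat_kernel_pow_mat_ind[OF A, of "k + 1"] by (simp add: k_def ac_simps)
  then have "A ^\<^sub>m k * C = A ^\<^sub>m k * D"
    by (rule mult_eq_of_mat_kernel_subset[OF P P C(1) D(1) _ eq])
  then show ?thesis by (simp only: C(2) D(2))
qed

lemma is_drazin_inverse_drazin_inverse: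
  assumes A: "A \<in> carrier_mat n n"
  shows "is_drazin_inverse A (drazin_inverse A)"
proof -
  obtain X where X: "is_drazin_inverse A X" using drazin_inverse_exists[OF A] by blast
  show ?thesis
    unfolding drazin_inverse_def
    by (rule theI[of "is_drazin_inverse A", OF X drazin_inverse_unique[OF A _ X]])
qed

section \<open>The nonsingular modification and Cramer's rule\<close>

text \<open>The number of columns of \<open>V\<close> is the nullity of \<open>P\<close>, which is the rank of \<open>V\<close>; hence \<open>V\<close> is
  injective. If \<open>W V v = 0\<close>, then \<open>V v\<close> lies both in the null space of \<open>P\<close> (the range of \<open>V\<close>) and in
  the range of \<open>P\<close> (the null space of \<open>W\<close>), so \<open>V v = 0\<close> and \<open>v = 0\<close>.\<close>
lemma det_mult_ne_0_of_complementary: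
  fixes P :: "'a::field mat"
  assumes P: "P \<in> carrier_mat n n"
    and compl: "\<And>v. v \<in> mat_kernel P \<Longrightarrow> v \<in> vec_space.col_space n P \<Longrightarrow> v = 0\<^sub>v n"
    and V: "V \<in> carrier_mat n m" and W: "W \<in> carrier_mat m n"
    and m: "m = n - vec_space.rank n P"
    and rV: "vec_space.col_space n V = mat_kernel P"
    and kW: "mat_kernel W = vec_space.col_space n P"
  shows "det (W * V) \<noteq> 0"
proof
  interpret R: vec_space "TYPE('a)" n .
  have WV: "W * V \<in> carrier_mat m m" using V W by simp
  have "R.rank V = kernel_dim P"
    using rV P by (simp add: R.rank_def R.col_space_def kernel_dim_def)
  also have "\<dots> = m" using m rank_add_kernel_dim[OF P] by simp
  finally have "kernel_dim V = 0" using rank_add_kernel_dim[OF V] by simp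
  then have "R.rank (V * 1\<^sub>m m) = vec_space.rank m (1\<^sub>m m :: 'a mat)"
    using V rank_add_kernel_dim[OF V] rank_add_kernel_dim[OF one_carrier_mat[of m, where 'a = 'a]]
      kernel_one_mat[of m, where 'a = 'a]
    by (simp add: kernel_dim_def)
  then have inj: "mat_kernel V = mat_kernel (1\<^sub>m m)"
    using mat_kernel_eq_of_rank_mult_eq[OF V one_carrier_mat] V by simp
  assume "det (W * V) = 0"
  then obtain v where v: "v \<in> carrier_vec m" "v \<noteq> 0\<^sub>v m" "W * V *\<^sub>v v = 0\<^sub>v m"
    using det_0_iff_vec_prod_zero_field[OF WV] by blast
  have Vv: "V *\<^sub>v v \<in> carrier_vec n" using V v by simp
  have "V *\<^sub>v v \<in> mat_kernel W"
    using v(1,3) V W Vv by (intro mat_kernelI[OF W]) simp_all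
  moreover have "V *\<^sub>v v \<in> mat_kernel P"
    unfolding rV[symmetric] R.col_space_eq[OF V] using V v Vv by auto
  ultimately have "V *\<^sub>v v = 0\<^sub>v n" using compl kW by simp
  then have "v \<in> mat_kernel (1\<^sub>m m)" using mat_kernelI[OF V v(1)] inj by simp
  then show False using v mat_kernelD[OF one_carrier_mat] by force
qed

text \<open>When \<open>Z\<close> inverts \<open>W V\<close>, the matrix \<open>E = V Z W\<close> is a projection onto the null space of \<open>P\<close>. If
  \<open>(P + E) u = 0\<close>, the vector \<open>E u = - P u\<close> is in the null space and in the range of \<open>P\<close>, so both
  parts vanish; then \<open>u\<close> lies in the null space of \<open>P\<close>, where \<open>E\<close> acts as the identity, and \<open>u = E u = 0\<close>.\<close>
lemma det_add_projection_ne_0: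
  fixes P :: "'a::field mat"
  assumes P: "P \<in> carrier_mat n n"
    and compl: "\<And>v. v \<in> mat_kernel P \<Longrightarrow> v \<in> vec_space.col_space n P \<Longrightarrow> v = 0\<^sub>v n"
    and V: "V \<in> carrier_mat n m" and W: "W \<in> carrier_mat m n" and Z: "Z \<in> carrier_mat m m"
    and rV: "vec_space.col_space n V = mat_kernel P"
    and inv: "Z * (W * V) = 1\<^sub>m m"
  shows "det (P + V * Z * W) \<noteq> 0"
proof
  interpret R: vec_space "TYPE('a)" n .
  let ?E = "V * Z * W"
  have VZ: "V * Z \<in> carrier_mat n m" using V Z by simp
  have E: "?E \<in> carrier_mat n n" using V Z W by simp
  assume "det (P + ?E) = 0"
  then obtain u where u: "u \<in> carrier_vec n" "u \<noteq> 0\<^sub>v n" "(P + ?E) *\<^sub>v u = 0\<^sub>v n"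
    using det_0_iff_vec_prod_zero_field[OF add_carrier_mat[OF E]] P by blast
  have Pu: "P *\<^sub>v u \<in> carrier_vec n" and Eu: "?E *\<^sub>v u \<in> carrier_vec n"
    using P E u by auto
  have sum0: "P *\<^sub>v u + ?E *\<^sub>v u = 0\<^sub>v n"
    using u(3) add_mult_distrib_mat_vec[OF P E u(1)] by simp
  have "?E *\<^sub>v u = V *\<^sub>v (Z *\<^sub>v (W *\<^sub>v u))"
    using assoc_mult_mat_vec[OF VZ W u(1)] assoc_mult_mat_vec[OF V Z, of "W *\<^sub>v u"] W u(1) by simp
  then have EuV: "?E *\<^sub>v u \<in> mat_kernel P"
    unfolding rV[symmetric] R.col_space_eq[OF V] using V Z W u(1)
    by (auto intro!: bexI[of _ "Z *\<^sub>v (W *\<^sub>v u)"])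
  have "?E *\<^sub>v u = P *\<^sub>v (- u)"
  proof (rule eq_vecI)
    fix i assume "i < dim_vec (P *\<^sub>v (- u))"
    then have i: "i < n" using P by simp
    show "(?E *\<^sub>v u) $ i = (P *\<^sub>v (- u)) $ i"
      using arg_cong[OF sum0, of "\<lambda>v. v $ i"] i P u(1) carrier_vecD[OF Eu]
        index_add_vec(1)[of i "?E *\<^sub>v u" "P *\<^sub>v u"]
      by (simp del: index_mult_mat_vec add: index_mult_mat_vec[of _ P] add_eq_0_iff)
  qed (use P E in auto)
  then have "?E *\<^sub>v u \<in> R.col_space P"
    unfolding R.col_space_eq[OF P] using P Eu u(1) by auto
  with EuV have E0: "?E *\<^sub>v u = 0\<^sub>v n" by (rule compl)
  then have "P *\<^sub>v u = 0\<^sub>v n" using sum0 Pu by simp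
  then have "u \<in> R.col_space V" using rV mat_kernelI[OF P u(1)] by simp
  then obtain y where y: "y \<in> carrier_vec m" "u = V *\<^sub>v y"
    unfolding R.col_space_eq[OF V] using V by auto
  have "?E * V = V * (Z * (W * V))"
    by (simp only: assoc_mult_mat[OF VZ W V] assoc_mult_mat[OF V Z mult_carrier_mat[OF W V]])
  also have "\<dots> = V" using V by (simp add: inv)
  finally have "?E *\<^sub>v u = u"
    using y(2) assoc_mult_mat_vec[OF E V y(1)] by simp
  then show False using E0 u(2) by simp
qed

theorem theorem5p4:
  fixes n k t :: nat
    and A V W E :: "complex mat"
    and b x :: "complex vec"
  assumes "A \<in> carrier_mat n n"
    and "k = mat_ind A"
    and "mat_rank (minkowski_adjoint A * A * minkowski_adjoint A) = mat_rank A"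
    and "b \<in> carrier_vec n"
    and "t = mat_rank (A ^\<^sub>m k)"
    and "V \<in> carrier_mat n (n - t)"
    and "W \<in> carrier_mat (n - t) n"
    and "mat_range V = mat_kernel (A ^\<^sub>m k)"
    and "mat_kernel W = mat_range (A ^\<^sub>m k)"
    and "E = V * the (mat_inverse (W * V)) * W"
    and "x = m_DMP_inverse A *\<^sub>v b"
  shows "invertible_mat (W * V) \<and> det (A ^\<^sub>m k + E) \<noteq> 0 \<and>
    (\<forall>i<n. x $ i =
       det (replace_col (A ^\<^sub>m k + E) (A ^\<^sub>m k * minkowski_inverse A *\<^sub>v b) i)
         / det (A ^\<^sub>m k + E))"
proof -
  interpret vec_space "TYPE(complex)" n .
  note A = assms(1) and k = assms(2) and b = assms(4) and V = assms(6) and W = assms(7)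
  define m where "m = n - t"
  define P where "P = A ^\<^sub>m k"
  define D where "D = drazin_inverse A"
  define M where "M = minkowski_inverse A"
  note assoc = assoc_mult_mat[of _ n n _ n _ n]
  have P: "P \<in> carrier_mat n n" using A by (simp add: P_def)
  have V: "V \<in> carrier_mat n m" and W: "W \<in> carrier_mat m n" using V W by (simp_all add: m_def)
  have WV: "W * V \<in> carrier_mat m m" using V W by simp
  have D: "D \<in> carrier_mat n n" "A * D = D * A" "P * A * D = P"
    using is_drazin_inverse_drazin_inverse[OF A] A k by (auto simp: is_drazin_inverse_def D_def P_def)
  have M: "M \<in> carrier_mat n n"
    using is_minkowski_inverse_minkowski_inverse[OF A assms(3)] A
    by (auto simp: is_minkowski_inverse_def M_def)
  have m: "m = n - rank P" using assms(5) P by (simp add: P_def[symmetric] m_def)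
  have rV: "col_space V = mat_kernel P" using assms(8) V by (simp add: P_def)
  have kW: "mat_kernel W = col_space P" using assms(9) P by (simp add: P_def[symmetric])
  have compl: "v = 0\<^sub>v n" if "v \<in> mat_kernel P" "v \<in> col_space P" for v
    using mat_kernel_range_pow_mat_ind[OF A, of v] that carrier_matD[OF P] by (simp add: P_def k)
  have detWV: "det (W * V) \<noteq> 0"
    using det_mult_ne_0_of_complementary[OF P _ V W m rV kW] compl by blast
  obtain Z where Z: "mat_inverse (W * V) = Some Z"
    using mat_inverse(1)[OF WV, of "()"] det_non_zero_imp_unit[OF WV detWV, of "()"] by blast
  have ZWV: "W * V * Z = 1\<^sub>m m" "Z * (W * V) = 1\<^sub>m m" and Zc: "Z \<in> carrier_mat m m"
    using mat_inverse(2)[OF WV Z] by auto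
  have inv: "invertible_mat (W * V)"
    unfolding invertible_mat_def inverts_mat_def using ZWV Zc WV V W by (auto intro!: exI[of _ Z])
  have E_eq: "E = V * Z * W" using assms(10) Z by simp
  have VZ: "V * Z \<in> carrier_mat n m" and E: "E \<in> carrier_mat n n" using V Zc W by (auto simp: E_eq)
  have det: "det (P + E) \<noteq> 0"
    using det_add_projection_ne_0[OF P _ V W Zc rV ZWV(2)] compl unfolding E_eq by blast
  have DA: "D * A \<in> carrier_mat n n" using D A by simp
  have Mb: "M *\<^sub>v b \<in> carrier_vec n" using M b by simp
  have x_eq: "x = D * A *\<^sub>v (M *\<^sub>v b)"
    unfolding assms(11) m_DMP_inverse_def D_def[symmetric] M_def[symmetric]
    by (rule assoc_mult_mat_vec[OF DA M b])
  then have x: "x \<in> carrier_vec n" using mult_mat_vec_carrier[OF DA Mb] by simp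
  (* P = A^k absorbs the projection D A, so P x = A^k A^m b. *)
  have "P * (D * A) = P"
    using assoc[OF P A D(1)] D(2,3) by simp
  then have Px: "P *\<^sub>v x = P * M *\<^sub>v b"
    unfolding x_eq assoc_mult_mat_vec[OF P DA Mb, symmetric] assoc_mult_mat_vec[OF P M b] by simp
  (* The solution x lies in the range of D, hence in that of P, which W annihilates: E x = 0. *)
  obtain C' where C': "C' \<in> carrier_mat n n" "D = P * C'"
    using drazin_inverse_factor[OF A is_drazin_inverse_drazin_inverse[OF A], of k]
    unfolding D_def P_def by blast
  define C where "C = C' * A"
  have C: "C \<in> carrier_mat n n" "D * A = P * C"
    unfolding C_def using C'(1) A by (simp, simp only: C'(2) assoc[OF P C'(1) A])
  have "x = P *\<^sub>v (C *\<^sub>v (M *\<^sub>v b))"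
    unfolding x_eq C(2) by (rule assoc_mult_mat_vec[OF P C(1) Mb])
  then have "x \<in> mat_kernel W"
    unfolding kW col_space_eq[OF P] using P C(1) Mb x by auto
  then have "E *\<^sub>v x = 0\<^sub>v n"
    unfolding E_eq assoc_mult_mat_vec[OF VZ W x] using mat_kernelD(2)[OF W] mult_mat_zero_vec[OF VZ] by simp
  then have "(P + E) *\<^sub>v x = P * M *\<^sub>v b"
    using add_mult_distrib_mat_vec[OF P E x] Px P M b by simp
  then have "det (replace_col (P + E) (P * M *\<^sub>v b) i) = x $ i * det (P + E)" if "i < n" for i
    using cramer_lemma_mat[OF add_carrier_mat[OF E, of P] x that] by simp
  then show ?thesis
    using inv det by (simp add: P_def M_def)
qed

end
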